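(* Let $G$ be a bridgeless connected graph with $d(G)=4$ and maximum edge girth $g^*(G)=9$. Then there is an orientation $\overrightarrow{G}$ of $G$ with $d(\overrightarrow{G})\le 12$. Consequently the oriented diameter satisfies $\overrightarrow{diam}(G)\le 12$.
   Context: Graphs are finite, connected, without loops (parallel edges allowed). $d(G)$ is the diameter of $G$. $G$ is bridgeless if no edge deletion disconnects it. For an edge $e$, the edge girth $l_G(e)$ is the length of a shortest cycle containing $e$, and $g^*(G)=\max\{l_G(e):e\in E(G)\}$. For an orientation $\overrightarrow{G}$ of $G$, $\partial(u,v)$ is the length of a shortest directed $u$–$v$ path and $d(\overrightarrow{G})=\max_{u,v}\partial(u,v)$. The oriented diameter $\overrightarrow{diam}(G)$ is the minimum of $d(\overrightarrow{G})$ over all strongly connected orientations $\overrightarrow{G}$ of $G$. *)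

theory Defs
  imports "Graph_Theory.Digraph_Component" "HOL-Library.Extended_Nat"
begin

section \<open>Undirected multigraphs\<close>

text \<open>Edges carry their own identity, so that parallel edges are possible; \<open>ends G e\<close> is the
  set of the two end vertices of the edge \<open>e\<close>.\<close>

record ('v, 'e) mgraph =
  vertices :: "'v set"
  edges :: "'e set"
  ends :: "'e \<Rightarrow> 'v set"

locale multigraph =
  fixes G :: "('v, 'e) mgraph"
  assumes finite_vertices: "finite (vertices G)"
    and finite_edges: "finite (edges G)"
    and ends_subset: "e \<in> edges G \<Longrightarrow> ends G e \<subseteq> vertices G"
    and no_loops: "e \<in> edges G \<Longrightarrow> card (ends G e) = 2"

text \<open>A path is given by its vertices \<open>vs\<close> and its edges \<open>es\<close>; its length is \<open>length es\<close>.\<close>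

definition is_path :: "('v, 'e) mgraph \<Rightarrow> 'v \<Rightarrow> 'v list \<Rightarrow> 'e list \<Rightarrow> 'v \<Rightarrow> bool" where
  "is_path G u vs es v \<longleftrightarrow>
     length vs = length es + 1 \<and> hd vs = u \<and> last vs = v \<and> distinct vs \<and>
     set vs \<subseteq> vertices G \<and> set es \<subseteq> edges G \<and>
     (\<forall>i < length es. ends G (es ! i) = {vs ! i, vs ! Suc i})"

text \<open>Two parallel edges form a cycle of length 2. Distinctness of \<open>es\<close> only matters for
  this length: it excludes going back and forth along one edge.\<close>

definition is_cycle :: "('v, 'e) mgraph \<Rightarrow> 'v list \<Rightarrow> 'e list \<Rightarrow> bool" where
  "is_cycle G vs es \<longleftrightarrow>
     length vs = length es \<and> 2 \<le> length es \<and> distinct vs \<and> distinct es \<and>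
     set vs \<subseteq> vertices G \<and> set es \<subseteq> edges G \<and>
     (\<forall>i < length es. ends G (es ! i) = {vs ! i, vs ! (Suc i mod length es)})"

definition mconnected :: "('v, 'e) mgraph \<Rightarrow> bool" where
  "mconnected G \<longleftrightarrow> vertices G \<noteq> {} \<and>
     (\<forall>u \<in> vertices G. \<forall>v \<in> vertices G. \<exists>vs es. is_path G u vs es v)"

definition delete_edge :: "('v, 'e) mgraph \<Rightarrow> 'e \<Rightarrow> ('v, 'e) mgraph" where
  "delete_edge G e = G \<lparr> edges := edges G - {e} \<rparr>"

text \<open>Intended for connected graphs.\<close>

definition bridgeless :: "('v, 'e) mgraph \<Rightarrow> bool" where
  "bridgeless G \<longleftrightarrow> (\<forall>e \<in> edges G. mconnected (delete_edge G e))"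

text \<open>Lengths are extended naturals: the infimum of a nonempty set is its minimum, and the
  length of a shortest path or cycle is \<open>\<infinity>\<close> if there is none. The supremum of a finite
  nonempty set is its maximum.\<close>

definition mdist :: "('v, 'e) mgraph \<Rightarrow> 'v \<Rightarrow> 'v \<Rightarrow> enat" where
  "mdist G u v = Inf {enat (length es) | vs es. is_path G u vs es v}"

definition diameter :: "('v, 'e) mgraph \<Rightarrow> enat" where
  "diameter G = (SUP u \<in> vertices G. SUP v \<in> vertices G. mdist G u v)"

definition edge_girth :: "('v, 'e) mgraph \<Rightarrow> 'e \<Rightarrow> enat" where
  "edge_girth G e = Inf {enat (length es) | vs es. is_cycle G vs es \<and> e \<in> set es}"

definition max_edge_girth :: "('v, 'e) mgraph \<Rightarrow> enat" where
  "max_edge_girth G = (SUP e \<in> edges G. edge_girth G e)"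

section \<open>Orientations\<close>

definition orientation :: "('v, 'e) mgraph \<Rightarrow> ('v, 'e) pre_digraph \<Rightarrow> bool" where
  "orientation G D \<longleftrightarrow> verts D = vertices G \<and> arcs D = edges G \<and>
     (\<forall>e \<in> edges G. {tail D e, head D e} = ends G e)"

definition ddist :: "('v, 'e) pre_digraph \<Rightarrow> 'v \<Rightarrow> 'v \<Rightarrow> enat" where
  "ddist D u v = Inf {enat (length p) | p. pre_digraph.apath D u p v}"

definition ddiameter :: "('v, 'e) pre_digraph \<Rightarrow> enat" where
  "ddiameter D = (SUP u \<in> verts D. SUP v \<in> verts D. ddist D u v)"

definition oriented_diameter :: "('v, 'e) mgraph \<Rightarrow> enat" where
  "oriented_diameter G = Inf {ddiameter D | D. orientation G D \<and> strongly_connected D}"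

end

theory Submission
  imports Defs "HOL-Number_Theory.Cong"
begin

text \<open>Let \<open>d\<close> be the diameter and let \<open>e = uv\<close> be an edge that lies on no cycle shorter than
  \<open>2d + 1\<close>. Distances from \<open>u\<close> and \<open>v\<close> in \<open>G - e\<close> yield a map from the vertices onto the integers
  modulo \<open>2d + 1\<close> that changes by at most one along each edge. Orient every edge that changes the
  level in the direction in which it goes up. If the level of \<open>y\<close> exceeds that of \<open>x\<close> by \<open>d\<close> modulo
  \<open>2d + 1\<close>, then a path of length at most \<open>d\<close> from \<open>x\<close> to \<open>y\<close> must go up in each of its steps,
  since going down would need \<open>d + 1\<close> steps. So it is a directed path of length \<open>d\<close>. From an
  arbitrary vertex one can therefore first go up at most \<open>2d\<close> times, until the target is exactly
  \<open>d\<close> levels above, and then follow such a path. This gives directed distances of at most \<open>3d\<close>.\<close>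

section \<open>Cyclic levels\<close>

text \<open>Levels stay integers compared by congruence, so that a sum of steps can be bounded in
  absolute value before it is reduced.\<close>

locale cyclic_levels =
  fixes V :: "'v set" and E :: "('v \<times> 'v) set" and level :: "'v \<Rightarrow> int" and d :: nat
  assumes d_pos: "0 < d"
    and level_step: "(x, y) \<in> E \<Longrightarrow> \<exists>k. \<bar>k\<bar> \<le> 1 \<and> [level y = level x + k] (mod 2 * int d + 1)"
    and level_onto: "\<exists>x\<in>V. [level x = k] (mod 2 * int d + 1)"
    and near: "x \<in> V \<Longrightarrow> y \<in> V \<Longrightarrow> \<exists>n\<le>d. (x, y) \<in> E ^^ n"
    and E_subset: "E \<subseteq> V \<times> V"
begin

definition up :: "('v \<times> 'v) set" where
  "up = {(x, y) \<in> E. [level y = level x + 1] (mod 2 * int d + 1)}"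

lemma level_walk:
  "(x, y) \<in> E ^^ n \<Longrightarrow> \<exists>k. \<bar>k\<bar> \<le> int n \<and> [level y = level x + k] (mod 2 * int d + 1)"
proof (induction n arbitrary: y)
  case 0
  then show ?case by auto
next
  case (Suc n)
  then obtain z where "(x, z) \<in> E ^^ n" and zy: "(z, y) \<in> E" by auto
  with Suc.IH obtain k where k: "\<bar>k\<bar> \<le> int n" "[level z = level x + k] (mod 2 * int d + 1)"
    by blast
  from level_step[OF zy] obtain j
    where j: "\<bar>j\<bar> \<le> 1" "[level y = level z + j] (mod 2 * int d + 1)" by blast
  have "[level y = level x + k + j] (mod 2 * int d + 1)"
    using j(2) cong_add[OF k(2) cong_refl[of j]] by (rule cong_trans)
  moreover have "\<bar>k + j\<bar> \<le> int (Suc n)" using k(1) j(1) by linarith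
  ultimately show ?case by (metis add.assoc)
qed

text \<open>Both \<open>k\<close> and \<open>int n\<close> lie between \<open>- int n\<close> and
  \<open>int n\<close>, so they differ by at most \<open>2 * int d\<close>, which is less than the
  modulus.\<close>

lemma cong_maximal:
  assumes "[a + k = a + int n] (mod 2 * int d + 1)" "\<bar>k\<bar> \<le> int n" "n \<le> d"
  shows "k = int n"
proof -
  have "[int n = k] (mod 2 * int d + 1)" using assms(1) by (simp add: cong_add_lcancel cong_sym)
  then have "2 * int d + 1 dvd int n - k" by (simp add: cong_iff_dvd_diff)
  moreover have "0 \<le> int n - k" "int n - k < 2 * int d + 1" using assms(2,3) by auto
  ultimately show ?thesis using zdvd_not_zless[of "int n - k" "2 * int d + 1"] by linarith
qed

text \<open>A gain of \<open>n\<close> in \<open>n\<close> steps that each gain at most one leaves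
  no slack: the last step gains exactly one, and induction handles the rest.\<close>

lemma up_walk:
  assumes "(x, y) \<in> E ^^ n" "n \<le> d" "[level y = level x + int n] (mod 2 * int d + 1)"
  shows "(x, y) \<in> up ^^ n"
  using assms
proof (induction n arbitrary: y)
  case 0
  then show ?case by simp
next
  case (Suc n)
  then obtain z where xz: "(x, z) \<in> E ^^ n" and zy: "(z, y) \<in> E" by auto
  from level_walk[OF xz] obtain k
    where k: "\<bar>k\<bar> \<le> int n" "[level z = level x + k] (mod 2 * int d + 1)" by blast
  from level_step[OF zy] obtain j
    where j: "\<bar>j\<bar> \<le> 1" "[level y = level z + j] (mod 2 * int d + 1)" by blast
  have "[level y = level x + (k + j)] (mod 2 * int d + 1)"
    using cong_trans[OF j(2) cong_add[OF k(2) cong_refl[of j]]] by (simp add: add.assoc)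
  then have "[level x + (k + j) = level x + int (Suc n)] (mod 2 * int d + 1)"
    using Suc.prems(3) by (meson cong_sym cong_trans)
  then have "k + j = int (Suc n)"
    using k(1) j(1) Suc.prems(2) by (intro cong_maximal[of "level x"]) auto
  then have "k = int n" "j = 1" using k(1) j(1) by auto
  then have "(x, z) \<in> up ^^ n" "(z, y) \<in> up"
    using Suc.IH[OF xz] Suc.prems(2) k(2) j(2) zy by (auto simp: up_def)
  then show ?case by auto
qed

lemma up_jump:
  assumes "x \<in> V" "y \<in> V" "[level y = level x + int d] (mod 2 * int d + 1)"
  shows "(x, y) \<in> up ^^ d"
proof -
  obtain n where n: "n \<le> d" "(x, y) \<in> E ^^ n" using near assms(1,2) by blast
  from level_walk[OF n(2)] obtain k
    where k: "\<bar>k\<bar> \<le> int n" "[level y = level x + k] (mod 2 * int d + 1)" by blast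
  have "[level x + k = level x + int d] (mod 2 * int d + 1)"
    using k(2) assms(3) by (meson cong_sym cong_trans)
  \<comment> \<open>Here \<open>cong_maximal\<close> is used with the bound \<open>d\<close> instead
    of \<open>n\<close>; a net gain of \<open>d\<close> then forces the walk to have full
    length.\<close>
  then have "k = int d" using k(1) n(1) by (intro cong_maximal[of "level x"]) auto
  then have "n = d" using k(1) n(1) by simp
  then show ?thesis using up_walk n assms(3) by blast
qed

text \<open>This is the first step of a jump to some vertex \<open>d\<close> levels higher;
  \<open>0 < d\<close> ensures that the jump has a first step.\<close>

lemma up_step:
  assumes "x \<in> V"
  shows "\<exists>y\<in>V. (x, y) \<in> up"
proof -
  obtain z where "z \<in> V" "[level z = level x + int d] (mod 2 * int d + 1)"
    using level_onto by blast
  then have "(x, z) \<in> up ^^ d" using up_jump assms by blast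
  then obtain y where "(x, y) \<in> up"
    using d_pos by (metis gr0_implies_Suc relpow_Suc_E2)
  then show ?thesis using E_subset by (auto simp: up_def)
qed

lemma up_steps:
  assumes "x \<in> V"
  shows "\<exists>y\<in>V. (x, y) \<in> up ^^ n \<and> [level y = level x + int n] (mod 2 * int d + 1)"
proof (induction n)
  case 0
  then show ?case using assms by auto
next
  case (Suc n)
  then obtain y where y: "y \<in> V" "(x, y) \<in> up ^^ n" "[level y = level x + int n] (mod 2 * int d + 1)"
    by blast
  obtain z where z: "z \<in> V" "(y, z) \<in> up" using up_step y(1) by blast
  have "[level z = level x + int n + 1] (mod 2 * int d + 1)"
    using z(2) cong_trans cong_add[OF y(3) cong_refl[of 1]] unfolding up_def by blast
  then show ?case using y(2) z by (intro bexI[of _ z]) (auto simp: algebra_simps)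
qed

lemma up_connected:
  assumes "x \<in> V" "y \<in> V"
  shows "\<exists>n\<le>3 * d. (x, y) \<in> up ^^ n"
proof -
  \<comment> \<open>After \<open>s\<close> steps up from \<open>x\<close>, the target
    \<open>y\<close> is \<open>d\<close> levels above modulo \<open>2 * d + 1\<close>. As a residue,
    \<open>s\<close> is at most \<open>2 * d\<close>.\<close>
  define s where "s = nat ((level y - level x - int d) mod (2 * int d + 1))"
  have s: "int s = (level y - level x - int d) mod (2 * int d + 1)"
    by (simp add: s_def)
  have "int s < 2 * int d + 1" unfolding s by (rule pos_mod_bound) simp
  then have "s + d \<le> 3 * d" by simp
  obtain z where z: "z \<in> V" "(x, z) \<in> up ^^ s" "[level z = level x + int s] (mod 2 * int d + 1)"
    using up_steps assms(1) by blast
  have "[int s = level y - level x - int d] (mod 2 * int d + 1)"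
    by (simp add: s cong_def)
  from cong_add[OF cong_refl[of "level x + int d"] this]
  have "[level y = level x + int s + int d] (mod 2 * int d + 1)"
    by (simp add: cong_sym_eq algebra_simps)
  then have "[level y = level z + int d] (mod 2 * int d + 1)"
    using cong_add[OF z(3) cong_refl[of "int d"]] by (meson cong_sym cong_trans)
  then have "(z, y) \<in> up ^^ d" using up_jump z(1) assms(2) by blast
  then have "(x, y) \<in> up ^^ (s + d)" using z(2) by (rule relpow_trans[rotated])
  then show ?thesis using \<open>s + d \<le> 3 * d\<close> by blast
qed

end

section \<open>Walks and distances\<close>

text \<open>Powers of this relation are walks; they compose without the distinctness conditions of
  paths.\<close>

definition adj :: "('v, 'e) mgraph \<Rightarrow> ('v \<times> 'v) set" where
  "adj G = {(x, y). \<exists>e\<in>edges G. ends G e = {x, y}}"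

lemma sym_adj: "sym (adj G)"
  by (auto simp: sym_def adj_def insert_commute)

lemma sym_relpow: "sym R \<Longrightarrow> sym (R ^^ n)"
proof (induction n)
  case (Suc n)
  then show ?case
    by (metis converse_relcomp relpow.simps(2) relpow_commute sym_conv_converse_eq)
qed (auto simp: sym_def)

lemma is_path_walk:
  assumes "is_path G x vs es y"
  shows "(x, y) \<in> adj G ^^ length es"
  unfolding relpow_fun_conv
proof (intro exI[of _ "\<lambda>i. vs ! i"] conjI allI impI)
  have "vs \<noteq> []" using assms by (auto simp: is_path_def)
  then show "vs ! 0 = x" "vs ! length es = y"
    using assms by (auto simp: is_path_def hd_conv_nth last_conv_nth)
  show "(vs ! i, vs ! Suc i) \<in> adj G" if "i < length es" for i
    using assms that by (auto simp: is_path_def adj_def intro!: bexI[of _ "es ! i"])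
qed

lemma mdist_le_walk:
  assumes "mdist G x y \<le> enat d"
  shows "\<exists>n\<le>d. (x, y) \<in> adj G ^^ n"
proof -
  have "mdist G x y < enat (Suc d)" using assms by (simp add: le_less_trans)
  then obtain vs es where "is_path G x vs es y" "length es < Suc d"
    unfolding mdist_def Inf_less_iff by auto
  then show ?thesis using is_path_walk by (metis less_Suc_eq_le)
qed

text \<open>The value is unspecified if there is no walk, hence the walk premises in the facts about
  it.\<close>

definition walk_dist :: "('v \<times> 'v) set \<Rightarrow> 'v \<Rightarrow> 'v \<Rightarrow> nat" where
  "walk_dist R x y = (LEAST n. (x, y) \<in> R ^^ n)"

lemma walk_dist_le: "(x, y) \<in> R ^^ n \<Longrightarrow> walk_dist R x y \<le> n"
  unfolding walk_dist_def by (rule Least_le)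

lemma walk_dist_walk: "(x, y) \<in> R ^^ n \<Longrightarrow> (x, y) \<in> R ^^ walk_dist R x y"
  unfolding walk_dist_def by (rule LeastI)

lemma walk_dist_step:
  assumes "(x, y) \<in> R ^^ n" "(y, z) \<in> R"
  shows "walk_dist R x z \<le> Suc (walk_dist R x y)"
  using walk_dist_walk[OF assms(1)] assms(2) by (intro walk_dist_le relpow_Suc_I)

text \<open>If a vertex were repeated, cutting out the part between its two visits would give a
  shorter walk.\<close>

lemma shortest_walk_inj:
  assumes f: "f 0 = x" "f (walk_dist R x y) = y"
    and step: "\<And>i. i < walk_dist R x y \<Longrightarrow> (f i, f (Suc i)) \<in> R"
  shows "inj_on f {..walk_dist R x y}"
proof (rule linorder_inj_onI)
  fix i j assume ij: "i < j" "i \<in> {..walk_dist R x y}" "j \<in> {..walk_dist R x y}"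
  have walk: "(f a, f b) \<in> R ^^ (b - a)" if "a \<le> b" "b \<le> walk_dist R x y" for a b
    unfolding relpow_fun_conv using that step by (intro exI[of _ "\<lambda>i. f (a + i)"]) auto
  show "f i \<noteq> f j"
  proof
    assume "f i = f j"
    then have "(x, f j) \<in> R ^^ i" "(f j, y) \<in> R ^^ (walk_dist R x y - j)"
      using walk[of 0 i] walk[of j "walk_dist R x y"] ij f by auto
    then have "(x, y) \<in> R ^^ (i + (walk_dist R x y - j))" by (rule relpow_trans)
    from walk_dist_le[OF this] show False using ij by auto
  qed
qed auto

text \<open>A shortest walk from \<open>v\<close> to \<open>u\<close> that avoids \<open>e\<close>
  has distinct vertices, so \<open>e\<close> closes it to a cycle with one more edge.\<close>

lemma edge_girth_le:
  assumes G: "multigraph G" and e: "e \<in> edges G" "ends G e = {u, v}"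
    and walk: "(v, u) \<in> adj (delete_edge G e) ^^ n"
  shows "edge_girth G e \<le> enat (Suc (walk_dist (adj (delete_edge G e)) v u))"
proof -
  let ?R = "adj (delete_edge G e)"
  define m where "m = walk_dist ?R v u"
  have uv: "u \<noteq> v" using multigraph.no_loops[OF G e(1)] e(2) by auto
  have "(v, u) \<in> ?R ^^ m" unfolding m_def using walk by (rule walk_dist_walk)
  then obtain f where f: "f 0 = v" "f m = u" and step: "\<And>i. i < m \<Longrightarrow> (f i, f (Suc i)) \<in> ?R"
    unfolding relpow_fun_conv by blast
  have m: "0 < m" using f uv by (cases m) auto
  have inj: "inj_on f {..m}"
    unfolding m_def by (rule shortest_walk_inj) (use f step in \<open>auto simp: m_def\<close>)
  have "\<forall>i. \<exists>h. i < m \<longrightarrow> h \<in> edges G - {e} \<and> ends G h = {f i, f (Suc i)}"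
    using step by (auto simp: adj_def delete_edge_def)
  then obtain g where g: "\<And>i. i < m \<Longrightarrow> g i \<in> edges G - {e}"
      "\<And>i. i < m \<Longrightarrow> ends G (g i) = {f i, f (Suc i)}"
    by metis
  \<comment> \<open>Since \<open>f\<close> is injective, different positions have different end
    sets, so no edge is chosen twice.\<close>
  have inj_g: "inj_on g {..<m}"
  proof (rule inj_onI)
    fix i j assume ij: "i \<in> {..<m}" "j \<in> {..<m}" "g i = g j"
    then have "{f i, f (Suc i)} = {f j, f (Suc j)}" using g(2) by (metis lessThan_iff)
    then have "f ` {i, Suc i} = f ` {j, Suc j}" by simp
    then have "{i, Suc i} = {j, Suc j}" using ij inj by (subst (asm) inj_on_image_eq_iff) auto
    then show "i = j" by (auto simp: doubleton_eq_iff)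
  qed
  \<comment> \<open>The edge \<open>e\<close> has index \<open>m\<close>, where the cyclic successor
    \<open>Suc m mod Suc m\<close> wraps around to \<open>f 0 = v\<close>.\<close>
  let ?vs = "map f [0..<Suc m]" and ?es = "map g [0..<m] @ [e]"
  have nth: "ends G (?es ! i) = {?vs ! i, ?vs ! (Suc i mod length ?es)}" if "i < length ?es" for i
  proof (cases "i = m")
    case True
    then show ?thesis using f e(2) by (simp add: nth_append nth_Cons' del: upt_Suc)
  next
    case False
    then show ?thesis using that g(2) by (simp add: nth_append del: upt_Suc)
  qed
  have "f i \<in> vertices G" if "i \<le> m" for i
  proof (cases "i = m")
    case True
    then show ?thesis using f e multigraph.ends_subset[OF G] by force
  next
    case False
    then show ?thesis using that g[of i] multigraph.ends_subset[OF G, of "g i"] by auto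
  qed
  then have vs: "set ?vs \<subseteq> vertices G" by (auto simp del: upt_Suc)
  have es: "set ?es \<subseteq> edges G" using g(1) e(1) by auto
  have dv: "distinct ?vs" using inj
    by (simp add: distinct_map atLeast0LessThan lessThan_Suc_atMost del: upt_Suc)
  have de: "distinct ?es" using inj_g g(1) by (auto simp: distinct_map atLeast0LessThan)
  have "is_cycle G ?vs ?es"
    unfolding is_cycle_def using nth vs es dv de m by (simp del: upt_Suc)
  then have "edge_girth G e \<le> enat (length ?es)"
    unfolding edge_girth_def by (intro Inf_lower) force
  then show ?thesis by (simp add: m_def)
qed

text \<open>A short walk in \<open>G\<close> from one end of \<open>e\<close> either avoids \<open>e\<close> or may be replaced by \<open>e\<close>
  followed by a walk avoiding \<open>e\<close>.\<close>

lemma walk_dist_delete_edge: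
  assumes e: "ends G e = {u, v}"
    and conn: "\<And>x y. x \<in> vertices G \<Longrightarrow> y \<in> vertices G \<Longrightarrow> \<exists>n. (x, y) \<in> adj (delete_edge G e) ^^ n"
    and sub: "adj G \<subseteq> vertices G \<times> vertices G" and uv: "u \<in> vertices G" "v \<in> vertices G"
    and walk: "(v, x) \<in> adj G ^^ n"
  shows "walk_dist (adj (delete_edge G e)) v x \<le> n \<or> walk_dist (adj (delete_edge G e)) u x < n"
  using walk
proof (induction n arbitrary: x)
  case 0
  then show ?case using walk_dist_le[of v x 0] by auto
next
  case (Suc n)
  let ?R = "adj (delete_edge G e)"
  from Suc.prems obtain y where y: "(v, y) \<in> adj G ^^ n" and yx: "(y, x) \<in> adj G" by auto
  then have V: "y \<in> vertices G" "x \<in> vertices G" using sub by auto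
  from yx consider "(y, x) \<in> ?R" | "{y, x} = {u, v}"
    using e by (auto simp: adj_def delete_edge_def)
  then show ?case
  proof cases
    case 1
    have "walk_dist ?R w x \<le> Suc (walk_dist ?R w y)" if "w \<in> vertices G" for w
      using conn[OF that V(1)] 1 by (blast intro: walk_dist_step)
    from this[OF uv(1)] this[OF uv(2)] show ?thesis using Suc.IH[OF y] by linarith
  next
    case 2
    \<comment> \<open>An end of \<open>e\<close> has distance 0 from itself, and
      \<open>0 < Suc n\<close> gives the strict bound if that end is \<open>u\<close>.\<close>
    then have "x = u \<or> x = v" by auto
    then show ?thesis using walk_dist_le[of x x 0 ?R] by auto
  qed
qed

section \<open>The orientation\<close>

text \<open>Deleting \<open>e\<close> leaves its ends at distance at least \<open>2 * d\<close>.
  Levels count up from 0 at \<open>v\<close> and, on the other side, down from \<open>2 * d\<close>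
  at \<open>u\<close>; these two values are consecutive modulo \<open>2 * d + 1\<close>, which
  accommodates \<open>e\<close> itself.\<close>

lemma exists_cyclic_levels:
  assumes G: "multigraph G" and bridgeless: "bridgeless G"
    and diam: "diameter G \<le> enat d" and d: "0 < d"
    and e: "e \<in> edges G" and girth: "enat (2 * d + 1) \<le> edge_girth G e"
  shows "\<exists>level. cyclic_levels (vertices G) (adj G) level d"
proof -
  obtain u v where uv: "ends G e = {u, v}" "u \<noteq> v"
    using multigraph.no_loops[OF G e] by (auto simp: card_2_iff)
  then have V: "u \<in> vertices G" "v \<in> vertices G"
    using multigraph.ends_subset[OF G e] by auto
  let ?R = "adj (delete_edge G e)"
  have sub: "adj G \<subseteq> vertices G \<times> vertices G"
    using multigraph.ends_subset[OF G] by (auto simp: adj_def)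
  have conn: "\<exists>n. (x, y) \<in> ?R ^^ n" if "x \<in> vertices G" "y \<in> vertices G" for x y
  proof -
    have "mconnected (delete_edge G e)" using bridgeless e by (simp add: bridgeless_def)
    moreover have "vertices (delete_edge G e) = vertices G" by (simp add: delete_edge_def)
    ultimately obtain vs es where "is_path (delete_edge G e) x vs es y"
      using \<open>x \<in> vertices G\<close> \<open>y \<in> vertices G\<close> unfolding mconnected_def by blast
    then show ?thesis using is_path_walk by metis
  qed
  have near: "\<exists>n\<le>d. (x, y) \<in> adj G ^^ n" if "x \<in> vertices G" "y \<in> vertices G" for x y
  proof (rule mdist_le_walk)
    have "mdist G x y \<le> diameter G"
      unfolding diameter_def by (meson SUP_upper2 order_refl that)
    then show "mdist G x y \<le> enat d" using diam by (rule order_trans)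
  qed
  define a where "a x = walk_dist ?R v x" for x
  define b where "b x = walk_dist ?R u x" for x
  have walk_a: "(v, x) \<in> ?R ^^ a x" and walk_b: "(u, x) \<in> ?R ^^ b x" if "x \<in> vertices G" for x
    using conn[OF V(2) that] conn[OF V(1) that] unfolding a_def b_def by (blast intro: walk_dist_walk)+
  have au: "2 * d \<le> a u"
  proof -
    obtain n where "(v, u) \<in> ?R ^^ n" using conn V by blast
    from edge_girth_le[OF G e uv(1) this]
    have "enat (2 * d + 1) \<le> enat (Suc (a u))" using girth unfolding a_def by (rule order_trans[rotated])
    then show ?thesis by simp
  qed
  have ab: "2 * d \<le> a x + b x" if x: "x \<in> vertices G" for x
  proof -
    have "(x, u) \<in> ?R ^^ b x"
      using walk_b[OF x] sym_relpow[OF sym_adj] by (metis symE)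
    then have "(v, u) \<in> ?R ^^ (a x + b x)" by (rule relpow_trans[OF walk_a[OF x]])
    then have "a u \<le> a x + b x" unfolding a_def by (rule walk_dist_le)
    then show ?thesis using au by linarith
  qed
  have dist_v: "a x \<le> d \<or> b x < d" if x: "x \<in> vertices G" for x
  proof -
    obtain n where "n \<le> d" "(v, x) \<in> adj G ^^ n" using near V(2) x by blast
    with walk_dist_delete_edge[OF uv(1) conn sub V] show ?thesis
      unfolding a_def b_def by fastforce
  qed
  have R_step: "a y \<le> Suc (a x)" "b y \<le> Suc (b x)" if "(x, y) \<in> ?R" for x y
  proof -
    have "(x, y) \<in> adj G" using that by (auto simp: adj_def delete_edge_def)
    then have "x \<in> vertices G" using sub by auto
    from walk_dist_step[OF walk_a[OF this] that] walk_dist_step[OF walk_b[OF this] that]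
    show "a y \<le> Suc (a x)" "b y \<le> Suc (b x)"
      unfolding a_def b_def .
  qed
  have a_v: "a v = 0" and b_u: "b u = 0"
    using walk_dist_le[of v v 0 ?R] walk_dist_le[of u u 0 ?R] by (auto simp: a_def b_def)
  \<comment> \<open>By \<open>dist_v\<close> the second branch has \<open>b x < d\<close>, so its
    levels exceed \<open>d\<close>, while those of the first branch do not.\<close>
  define level where "level x = (if a x \<le> d then int (a x) else 2 * int d - int (b x))" for x
  have level_v: "level v = 0" and level_u: "level u = 2 * int d"
    using a_v b_u au d by (auto simp: level_def)
  \<comment> \<open>Within a branch this is the triangle inequality. Across branches, the far vertex
    has \<open>a = d + 1\<close>, so \<open>ab\<close> and \<open>dist_v\<close> force
    \<open>b = d - 1\<close> there, and the levels are \<open>d\<close> and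
    \<open>d + 1\<close>.\<close>
  have level_R: "\<bar>level y - level x\<bar> \<le> 1" if xy: "(x, y) \<in> ?R" for x y
  proof -
    have yx: "(y, x) \<in> ?R" using xy sym_adj by (metis symE)
    have "(x, y) \<in> adj G" using xy by (auto simp: adj_def delete_edge_def)
    then have "x \<in> vertices G" "y \<in> vertices G" using sub by auto
    then show ?thesis
      using R_step[OF xy] R_step[OF yx] ab[of x] ab[of y] dist_v[of x] dist_v[of y]
      unfolding level_def by (auto split: if_splits)
  qed
  \<comment> \<open>Discrete intermediate values: a walk from \<open>v\<close> avoiding
    \<open>e\<close> starts at level 0 and skips no level. Its use with end \<open>u\<close> covers
    all residues.\<close>
  have level_all: "\<exists>z\<in>vertices G. level z = k" if "(v, y) \<in> ?R ^^ n" "0 \<le> k" "k \<le> level y" for y n k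
    using that
  proof (induction n arbitrary: y)
    case 0
    then have "k = level v" using level_v by simp
    then show ?case using V by blast
  next
    case (Suc n)
    then obtain x where x: "(v, x) \<in> ?R ^^ n" "(x, y) \<in> ?R" by auto
    have "y \<in> vertices G" using x(2) sub by (auto simp: adj_def delete_edge_def)
    then show ?case
      using Suc.IH[OF x(1)] Suc.prems(2,3) level_R[OF x(2)] by (cases "k \<le> level x") force+
  qed
  have "cyclic_levels (vertices G) (adj G) level d"
  proof
    show "0 < d" by (fact d)
    show "\<exists>k. \<bar>k\<bar> \<le> 1 \<and> [level y = level x + k] (mod 2 * int d + 1)" if "(x, y) \<in> adj G" for x y
    proof (cases "(x, y) \<in> ?R")
      case True
      then show ?thesis using level_R by (intro exI[of _ "level y - level x"]) auto
    next
      case False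
      \<comment> \<open>Only the ends of \<open>e\<close> remain: from \<open>u\<close> to
        \<open>v\<close> the level drops by \<open>2 * d\<close>, which is a rise by one modulo
        \<open>2 * d + 1\<close>.\<close>
      then have "{x, y} = {u, v}" using that uv by (auto simp: adj_def delete_edge_def)
      then have "x = u \<and> y = v \<or> x = v \<and> y = u" by (auto simp: doubleton_eq_iff)
      then show ?thesis
      proof
        assume "x = u \<and> y = v"
        then show ?thesis
          using level_u level_v by (intro exI[of _ 1]) (auto simp: cong_def)
      next
        assume "x = v \<and> y = u"
        then show ?thesis
          using level_u level_v by (intro exI[of _ "-1"]) (auto simp: cong_iff_dvd_diff)
      qed
    qed
    show "\<exists>x\<in>vertices G. [level x = k] (mod 2 * int d + 1)" for k
    proof -
      have "0 \<le> k mod (2 * int d + 1)" "k mod (2 * int d + 1) < 2 * int d + 1"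
        using pos_mod_bound[of "2 * int d + 1"] by simp_all
      then obtain z where "z \<in> vertices G" "level z = k mod (2 * int d + 1)"
        using level_all[OF walk_a[OF V(1)], of "k mod (2 * int d + 1)"] level_u by auto
      then show ?thesis by (intro bexI[of _ z]) (simp_all add: cong_def)
    qed
  qed (use near sub in auto)
  then show ?thesis by blast
qed

section \<open>Directed walks and the choice of edge directions\<close>

lemma (in wf_digraph) length_awalk_to_apath:
  "awalk u p v \<Longrightarrow> length (awalk_to_apath p) \<le> length p"
proof (induct rule: awalk_to_apath_induct)
  case (path p)
  then show ?case by (auto simp: awalk_to_apath.simps)
next
  case (decomp p q r s)
  then have "p = q @ r @ s" by (auto elim: awalk_cyc_decompE)
  then show ?case using decomp step_awalk_to_apath[of _ p _ q r s] by auto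
qed

lemma (in wf_digraph) relpow_arcs_ends_awalk:
  assumes "(x, y) \<in> arcs_ends G ^^ n" "x \<in> verts G"
  shows "\<exists>p. awalk x p y \<and> length p = n"
  using assms
proof (induction n arbitrary: x)
  case 0
  then show ?case by (auto simp: awalk_Nil_iff)
next
  case (Suc n)
  then obtain z where z: "(x, z) \<in> arcs_ends G" "(z, y) \<in> arcs_ends G ^^ n"
    by (meson relpow_Suc_E2)
  then obtain f where f: "f \<in> arcs G" "tail G f = x" "head G f = z"
    by (auto simp: arcs_ends_def arc_to_ends_def)
  then obtain p where "awalk z p y" "length p = n" using Suc.IH z(2) by fastforce
  then show ?case using f by (intro exI[of _ "f # p"]) (auto simp: awalk_Cons_iff)
qed

text \<open>The end set of an edge can be read in two orders; \<open>antisym\<close> makes the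
  direction demanded by \<open>up\<close> unique. Edges on which \<open>up\<close> makes no demand
  get an arbitrary direction.\<close>

lemma exists_orientation:
  assumes G: "multigraph G" and up: "up \<subseteq> adj G"
    and antisym: "\<And>x y. (x, y) \<in> up \<Longrightarrow> (y, x) \<notin> up"
  shows "\<exists>D. orientation G D \<and> wf_digraph D \<and> up \<subseteq> arcs_ends D"
proof -
  have "\<forall>f. \<exists>p. f \<in> edges G \<longrightarrow> {fst p, snd p} = ends G f \<and>
      (\<forall>x y. ends G f = {x, y} \<and> (x, y) \<in> up \<longrightarrow> p = (x, y))"
  proof
    fix f
    show "\<exists>p. f \<in> edges G \<longrightarrow> {fst p, snd p} = ends G f \<and>
      (\<forall>x y. ends G f = {x, y} \<and> (x, y) \<in> up \<longrightarrow> p = (x, y))"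
    proof (cases "\<exists>x y. ends G f = {x, y} \<and> (x, y) \<in> up")
      case True
      then obtain x y where xy: "ends G f = {x, y}" "(x, y) \<in> up" by blast
      then show ?thesis
        using antisym by (intro exI[of _ "(x, y)"]) (auto simp: doubleton_eq_iff)
    next
      case False
      show ?thesis
      proof (cases "f \<in> edges G")
        case True
        then obtain x y where "ends G f = {x, y}"
          using multigraph.no_loops[OF G] by (meson card_2_iff)
        with False show ?thesis by (intro exI[of _ "(x, y)"]) auto
      qed auto
    qed
  qed
  then obtain p where p: "\<And>f. f \<in> edges G \<Longrightarrow> {fst (p f), snd (p f)} = ends G f"
      "\<And>f x y. f \<in> edges G \<Longrightarrow> ends G f = {x, y} \<Longrightarrow> (x, y) \<in> up \<Longrightarrow> p f = (x, y)"
    by metis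
  define D where "D = \<lparr>verts = vertices G, arcs = edges G, tail = fst \<circ> p, head = snd \<circ> p\<rparr>"
  have "orientation G D" using p(1) by (simp add: orientation_def D_def)
  moreover have "wf_digraph D"
    using p(1) multigraph.ends_subset[OF G] by unfold_locales (fastforce simp: D_def)+
  moreover have "up \<subseteq> arcs_ends D"
  proof (rule subrelI)
    fix x y assume "(x, y) \<in> up"
    then obtain f where "f \<in> edges G" "ends G f = {x, y}" "p f = (x, y)"
      using up p(2) by (fastforce simp: adj_def)
    then show "(x, y) \<in> arcs_ends D"
      by (force simp: arcs_ends_def arc_to_ends_def D_def)
  qed
  ultimately show ?thesis by blast
qed

text \<open>For \<open>d = 4\<close> the girth bound \<open>2 * d + 1\<close> is 9 and the resulting
  bound \<open>3 * d\<close> is 12.\<close>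

theorem oriented_diameter_le_3_diameter:
  assumes G: "multigraph G" "bridgeless G"
    and diam: "diameter G \<le> enat d" and d: "0 < d"
    and e: "e \<in> edges G" "enat (2 * d + 1) \<le> edge_girth G e"
  shows "\<exists>D. orientation G D \<and> strongly_connected D \<and> ddiameter D \<le> enat (3 * d)"
proof -
  obtain level where "cyclic_levels (vertices G) (adj G) level d"
    using exists_cyclic_levels[OF G diam d e] by blast
  then interpret cyclic_levels "vertices G" "adj G" level d .
  have antisym: "(y, x) \<notin> up" if xy: "(x, y) \<in> up" for x y
  proof
    assume yx: "(y, x) \<in> up"
    \<comment> \<open>The sum of the two differences is \<open>-2\<close>, while the modulus is at
      least 3.\<close>
    have "2 * int d + 1 dvd (level x - (level y + 1)) + (level y - (level x + 1))"
      using xy yx by (intro dvd_add) (simp_all add: up_def cong_iff_dvd_diff)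
    then have "2 * int d + 1 dvd 2" by simp
    then show False using d zdvd_imp_le[of "2 * int d + 1" 2] by simp
  qed
  have "up \<subseteq> adj G" by (auto simp: up_def)
  then obtain D where D: "orientation G D" "wf_digraph D" "up \<subseteq> arcs_ends D"
    using exists_orientation[OF G(1) _ antisym] by blast
  interpret D: wf_digraph D by (fact D(2))
  have verts: "verts D = vertices G" using D(1) by (simp add: orientation_def)
  have walk: "\<exists>p. D.awalk x p y \<and> length p \<le> 3 * d" if xy: "x \<in> verts D" "y \<in> verts D" for x y
  proof -
    obtain n where n: "n \<le> 3 * d" "(x, y) \<in> up ^^ n" using up_connected xy unfolding verts by blast
    then have "(x, y) \<in> arcs_ends D ^^ n" using D(3) unfolding relpow_fun_conv by blast
    then show ?thesis using D.relpow_arcs_ends_awalk xy n(1) by blast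
  qed
  have "ddist D x y \<le> enat (3 * d)" if xy: "x \<in> verts D" "y \<in> verts D" for x y
  proof -
    \<comment> \<open>The walk may repeat vertices, but \<open>ddist\<close> ranges over paths;
      cutting out cycles does not lengthen it.\<close>
    obtain p where p: "D.awalk x p y" "length p \<le> 3 * d" using walk xy by blast
    have "ddist D x y \<le> enat (length (D.awalk_to_apath p))"
      unfolding ddist_def using D.apath_awalk_to_apath[OF p(1)] by (intro Inf_lower) blast
    also have "\<dots> \<le> enat (3 * d)" using D.length_awalk_to_apath[OF p(1)] p(2) by simp
    finally show ?thesis .
  qed
  then have "ddiameter D \<le> enat (3 * d)" unfolding ddiameter_def by (intro SUP_least)
  moreover have "strongly_connected D"
    unfolding strongly_connected_def
  proof (intro conjI ballI)
    show "verts D \<noteq> {}" using level_onto[of 0] verts by auto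
    show "x \<rightarrow>\<^sup>*\<^bsub>D\<^esub> y" if "x \<in> verts D" "y \<in> verts D" for x y
      using walk[OF that] by (auto intro: D.reachable_awalkI)
  qed
  ultimately show ?thesis using D(1) by blast
qed

theorem theorem1p3:
  fixes G :: "('v, 'e) mgraph"
  assumes "multigraph G"
    and "mconnected G"
    and "bridgeless G"
    and "diameter G = 4"
    and "max_edge_girth G = 9"
  shows "(\<exists>D. orientation G D \<and> ddiameter D \<le> 12) \<and> oriented_diameter G \<le> 12"
proof -
  \<comment> \<open>A supremum above 8 yields an edge whose girth exceeds 8 and is therefore at
    least 9.\<close>
  have "enat 8 < max_edge_girth G" by (simp add: assms(5) numeral_eq_enat)
  then obtain e where e: "e \<in> edges G" "enat 8 < edge_girth G e"
    unfolding max_edge_girth_def less_SUP_iff by blast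
  then have "enat (2 * 4 + 1) \<le> edge_girth G e"
    by (cases "edge_girth G e") auto
  then obtain D where D: "orientation G D" "strongly_connected D" "ddiameter D \<le> enat (3 * 4)"
    using oriented_diameter_le_3_diameter[OF assms(1,3), of 4 e] assms(4) e(1)
    by (auto simp: numeral_eq_enat)
  then have "oriented_diameter G \<le> ddiameter D"
    unfolding oriented_diameter_def by (intro Inf_lower) blast
  then show ?thesis using D by (auto simp: numeral_eq_enat intro: order_trans)
qed

end
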